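(* For any fixed integer $n\geq 3$, $\chi_L(T(n,k))=o(k)$ as $k\to\infty$, i.e. $\displaystyle\lim_{k\to\infty}\frac{\chi_L(T(n,k))}{k}=0$.
   Context: All graphs are simple, undirected and connected. A $k$-coloring of a graph $G$ is a map $c:V(G)\to\{1,\dots,k\}$ with $c(u)\neq c(v)$ whenever $u,v$ are adjacent. If $\Pi=\{C_1,\dots,C_k\}$ is the partition of $V(G)$ into color classes, the color code of a vertex $v$ is $(d(v,C_1),\dots,d(v,C_k))$, where $d(v,C_i)=\min\{d(v,x):x\in C_i\}$. The coloring is a locating $k$-coloring if all vertices have distinct color codes, and $\chi_L(G)$ is the smallest $k$ for which $G$ has a locating $k$-coloring. For integers $n\geq 2$, $k\geq 1$, $T(n,k)$ is defined recursively: $T(n,1)$ is the star $K_{1,n}$, and for $k\geq 2$, $T(n,k)$ is obtained from $n$ disjoint copies of $T(n,k-1)$ by adding a new vertex (the center of $T(n,k)$) adjacent to the center of each copy. *)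

theory Defs
  imports Complex_Main "Graph_Theory.Graph_Theory"
begin

text \<open>Undirected simple graphs are rendered as in \<^theory>\<open>Graph_Theory.Graph_Theory\<close>: a graph is a
  finite, loop-free digraph without parallel arcs whose arc relation is symmetric. The definitions
  below are for arbitrary \<^typ>\<open>('a, 'b) pre_digraph\<close>s but are meaningful for connected graphs;
  the trees considered here are shown to be such.\<close>

text \<open>The number of edges on a shortest walk, as the library's shortest-path cost for unit
  weights.\<close>
definition gdist :: "('a, 'b) pre_digraph \<Rightarrow> 'a \<Rightarrow> 'a \<Rightarrow> ereal" where
  "gdist G u v = wf_digraph.\<mu> G (\<lambda>_. 1) u v"

text \<open>The infimum is a minimum whenever the graph is finite and \<open>C\<close> is a nonempty set of
  vertices.\<close>
definition set_gdist :: "('a, 'b) pre_digraph \<Rightarrow> 'a \<Rightarrow> 'a set \<Rightarrow> ereal" where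
  "set_gdist G v C = (INF x\<in>C. gdist G v x)"

definition k_coloring :: "('a, 'b) pre_digraph \<Rightarrow> nat \<Rightarrow> ('a \<Rightarrow> nat) \<Rightarrow> bool" where
  "k_coloring G k c \<longleftrightarrow>
     c ` verts G \<subseteq> {1..k} \<and> (\<forall>u v. u \<rightarrow>\<^bsub>G\<^esub> v \<longrightarrow> c u \<noteq> c v)"

definition color_class :: "('a, 'b) pre_digraph \<Rightarrow> ('a \<Rightarrow> nat) \<Rightarrow> nat \<Rightarrow> 'a set" where
  "color_class G c i = {v \<in> verts G. c v = i}"

definition color_code :: "('a, 'b) pre_digraph \<Rightarrow> nat \<Rightarrow> ('a \<Rightarrow> nat) \<Rightarrow> 'a \<Rightarrow> ereal list" where
  "color_code G k c v = map (\<lambda>i. set_gdist G v (color_class G c i)) [1..<Suc k]"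

text \<open>The \<open>k\<close> color classes have to form a partition of the vertex set, so none of them may be
  empty; this also makes every entry of a color code a minimum over a nonempty set.\<close>
definition locating_coloring :: "('a, 'b) pre_digraph \<Rightarrow> nat \<Rightarrow> ('a \<Rightarrow> nat) \<Rightarrow> bool" where
  "locating_coloring G k c \<longleftrightarrow>
     k_coloring G k c \<and> (\<forall>i\<in>{1..k}. color_class G c i \<noteq> {}) \<and>
     inj_on (color_code G k c) (verts G)"

definition locating_chromatic_number :: "('a, 'b) pre_digraph \<Rightarrow> nat" where
  "locating_chromatic_number G = (LEAST k. \<exists>c. locating_coloring G k c)"

text \<open>Vertices of the trees are lists of naturals: the center is always the empty list, and
  prefixing \<open>i\<close> yields the \<open>i\<close>-th disjoint copy, whose center is therefore \<open>[i]\<close>.\<close>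

definition star :: "nat \<Rightarrow> nat list pair_pre_digraph" where
  "star n = \<lparr> pverts = insert [] ((\<lambda>i. [i]) ` {..<n}),
              parcs = (\<Union>i<n. {([], [i]), ([i], [])}) \<rparr>"

definition join_copies :: "nat \<Rightarrow> nat list pair_pre_digraph \<Rightarrow> nat list pair_pre_digraph" where
  "join_copies n H =
     \<lparr> pverts = insert [] (\<Union>i<n. Cons i ` pverts H),
       parcs = (\<Union>i<n. map_prod (Cons i) (Cons i) ` parcs H) \<union>
               (\<Union>i<n. {([], [i]), ([i], [])}) \<rparr>"

text \<open>The value at \<open>k = 0\<close> is a mere convention; it is chosen such that the recursion also holds
  there.\<close>
fun T :: "nat \<Rightarrow> nat \<Rightarrow> nat list pair_pre_digraph" where
  "T n 0 = \<lparr> pverts = {[]}, parcs = {} \<rparr>"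
| "T n (Suc 0) = star n"
| "T n (Suc (Suc k)) = join_copies n (T n (Suc k))"

lemma T_Suc: "T n (Suc k) = join_copies n (T n k)"
  by (cases k) (auto simp: star_def join_copies_def)

lemma Nil_in_T: "[] \<in> pverts (T n k)"
  by (cases k) (auto simp: T_Suc join_copies_def simp del: T.simps(2,3))

lemma pair_graph_join_copies:
  assumes "pair_graph H" "[] \<in> pverts H"
  shows "pair_graph (join_copies n H)"
proof -
  interpret H: pair_graph H by fact
  have sym: "(v, u) \<in> parcs H" if "(u, v) \<in> parcs H" for u v
    using that H.pair_sym_arcs by (auto simp: symmetric_def sym_def)
  show ?thesis
  proof unfold_locales
    show "symmetric (with_proj (join_copies n H))"
      unfolding symmetric_def with_proj_simps
    proof (rule symI)
      fix a b assume "(a, b) \<in> parcs (join_copies n H)"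
      then consider i u v where "i < n" "(u, v) \<in> parcs H" "a = i # u" "b = i # v"
        | i where "i < n" "{a, b} = {[], [i]}"
        by (auto simp: join_copies_def)
      then show "(b, a) \<in> parcs (join_copies n H)"
      proof cases
        case 1
        have "(i # v, i # u) \<in> map_prod (Cons i) (Cons i) ` parcs H"
          using sym[OF 1(2)] by (rule rev_image_eqI) simp
        with 1 show ?thesis
          by (auto simp: join_copies_def)
      next
        case 2
        then show ?thesis
          by (auto simp: join_copies_def doubleton_eq_iff)
      qed
    qed
  qed (auto simp: join_copies_def image_iff assms(2) H.pair_finite_verts H.pair_finite_arcs
        dest: H.in_arcsD1 H.in_arcsD2 H.pair_no_loops)
qed

lemma pair_graph_T: "pair_graph (T n k)"
proof (induction k)
  case 0
  show ?case
    by unfold_locales (auto simp: symmetric_def sym_def)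
next
  case (Suc k)
  then show ?case
    unfolding T_Suc by (rule pair_graph_join_copies[OF _ Nil_in_T])
qed

lemma reachable_Nil_T:
  assumes "v \<in> pverts (T n k)"
  shows "v \<rightarrow>\<^sup>*\<^bsub>with_proj (T n k)\<^esub> []"
  using assms
proof (induction k arbitrary: v)
  case 0
  then show ?case
    by (simp add: reachable_def)
next
  case (Suc k)
  interpret G: pair_graph "T n (Suc k)" by (rule pair_graph_T)
  show ?case
  proof (cases v)
    case Nil
    then show ?thesis
      using Suc.prems by (simp add: reachable_def)
  next
    case (Cons i w)
    then have i: "i < n" and w: "w \<in> pverts (T n k)"
      using Suc.prems by (auto simp: T_Suc join_copies_def simp del: T.simps(2,3))
    have lift: "(i # u, i # x) \<in> rtrancl_on (pverts (T n (Suc k))) (parcs (T n (Suc k)))"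
      if "(u, x) \<in> rtrancl_on (pverts (T n k)) (parcs (T n k))" for u x
      using that
    proof (induction rule: rtrancl_on.induct)
      case (rtrancl_on_refl a)
      then show ?case
        using i by (auto simp: T_Suc join_copies_def simp del: T.simps(2,3))
    next
      case (rtrancl_on_into_rtrancl_on a y z)
      have arc: "(i # y, i # z) \<in> parcs (T n (Suc k))"
        using rtrancl_on_into_rtrancl_on.hyps(2) i
        by (force simp: T_Suc join_copies_def simp del: T.simps(2,3))
      show ?case
        by (rule rtrancl_on.rtrancl_on_into_rtrancl_on
            [OF rtrancl_on_into_rtrancl_on.IH arc G.in_arcsD2[OF arc]])
    qed
    have "(i # w, [i]) \<in> rtrancl_on (pverts (T n (Suc k))) (parcs (T n (Suc k)))"
      using Suc.IH[OF w] by (intro lift) (simp add: reachable_def)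
    moreover have "([i], []) \<in> parcs (T n (Suc k))"
      using i by (auto simp: T_Suc join_copies_def simp del: T.simps(2,3))
    ultimately have "(i # w, []) \<in> rtrancl_on (pverts (T n (Suc k))) (parcs (T n (Suc k)))"
      by (rule rtrancl_on_into_rtrancl_on) (rule Nil_in_T)
    then show ?thesis
      using Cons by (simp add: reachable_def)
  qed
qed

lemma connected_T: "connected (with_proj (T n k))"
proof -
  interpret G: pair_graph "T n k" by (rule pair_graph_T)
  have sym: "(parcs (T n k))\<^sup>s = parcs (T n k)"
    using G.pair_sym_arcs by (auto simp: symcl_def symmetric_def sym_def)
  have "u \<rightarrow>\<^sup>*\<^bsub>with_proj (T n k)\<^esub> v" if "u \<in> pverts (T n k)" "v \<in> pverts (T n k)" for u v
    using reachable_Nil_T[OF that(1)]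
      symmetric_reachable[OF G.pair_sym_arcs reachable_Nil_T[OF that(2)]]
    by (rule G.reachable_trans)
  moreover have "pverts (T n k) \<noteq> {}"
    using Nil_in_T[of n k] by auto
  ultimately show ?thesis
    by (simp add: connected_conv sym reachable_def)
qed

lemma (in wf_digraph) gdist_eq_INF_length:
  "gdist G u v = (INF p\<in>{p. awalk u p v}. ereal (real (length p)))"
proof -
  have "awalk_cost (\<lambda>_. 1) p = real (length p)" for p
    by (induction p) auto
  then show ?thesis
    by (simp add: gdist_def \<mu>_def)
qed

lemma (in wf_digraph) gdist_eq_0_iff:
  assumes "u \<in> verts G"
  shows "gdist G u v = 0 \<longleftrightarrow> u = v"
proof
  assume "u = v"
  then have "gdist G u v \<le> 0"
    using assms unfolding gdist_eq_INF_length
    by (intro INF_lower2[of "[]"]) (auto simp: awalk_Nil_iff)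
  moreover have "gdist G u v \<ge> 0"
    unfolding gdist_eq_INF_length by (intro INF_greatest) auto
  ultimately show "gdist G u v = 0" by simp
next
  assume *: "gdist G u v = 0"
  show "u = v"
  proof (rule ccontr)
    assume "u \<noteq> v"
    then have "1 \<le> ereal (real (length p))" if "awalk u p v" for p
      using that by (cases p) (auto simp: awalk_Nil_iff)
    then have "gdist G u v \<ge> 1"
      unfolding gdist_eq_INF_length by (intro INF_greatest) auto
    with * show False by simp
  qed
qed

text \<open>Giving all vertices different colors yields a locating coloring, so the \<open>LEAST\<close> in the
  definition of the locating chromatic number is attained.\<close>
lemma (in digraph) locating_coloring_exists: "\<exists>k c. locating_coloring G k c"
proof -
  obtain c where c: "bij_betw c (verts G) {1..card (verts G)}"
    using finite_same_card_bij[OF finite_verts, of "{1..card (verts G)}"] by auto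
  let ?k = "card (verts G)"
  have cls: "color_class G c (c v) = {v}" if "v \<in> verts G" for v
    using inj_onD[OF bij_betw_imp_inj_on[OF c] _ _ that] that by (auto simp: color_class_def)
  have ne: "color_class G c i \<noteq> {}" if i: "i \<in> {1..?k}" for i
  proof -
    obtain v where "v \<in> verts G" "i = c v"
      using i bij_betw_imp_surj_on[OF c] by blast
    then show ?thesis
      by (auto simp: color_class_def)
  qed
  have "inj_on (color_code G ?k c) (verts G)"
  proof (rule inj_onI)
    fix u v assume uv: "u \<in> verts G" "v \<in> verts G" "color_code G ?k c u = color_code G ?k c v"
    have "c v \<in> {1..?k}"
      using c uv by (auto simp: bij_betw_def)
    then have "set_gdist G u (color_class G c (c v)) = set_gdist G v (color_class G c (c v))"
      using uv(3) unfolding color_code_def map_eq_conv set_upt by auto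
    then have "gdist G u v = gdist G v v"
      by (simp add: cls uv set_gdist_def)
    then show "u = v"
      using gdist_eq_0_iff[OF uv(1), of v] gdist_eq_0_iff[OF uv(2), of v] by simp
  qed
  moreover have "k_coloring G ?k c"
    unfolding k_coloring_def
  proof (intro conjI allI impI)
    show "c ` verts G \<subseteq> {1..?k}"
      using c by (simp add: bij_betw_def)
    fix u v assume uv: "u \<rightarrow>\<^bsub>G\<^esub> v"
    then have "u \<noteq> v"
      using adj_not_same by blast
    then show "c u \<noteq> c v"
      using inj_onD[OF bij_betw_imp_inj_on[OF c] _ adj_in_verts[OF uv]] by blast
  qed
  ultimately show ?thesis
    using ne unfolding locating_coloring_def by blast
qed

end

theory Submission
  imports Defs
begin

text \<open>A vertex is the word of branching choices leading to it from the root. Cut these words into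
  windows of \<open>m\<close> letters and spend one color on each window: below every vertex \<open>a\<close> at depth
  \<open>(i + 1) m\<close>, all vertices at one depth \<open>\<lambda>\<close>, slightly larger than that of \<open>a\<close>, get color \<open>i\<close>,
  where \<open>\<lambda>\<close> encodes the \<open>i\<close>-th window of \<open>a\<close>. A deeper vertex \<open>u\<close> below \<open>a\<close> then has distance
  \<open>\<bar>u\<bar> - \<lambda>\<close> to color \<open>i\<close>, from which the window can be read off. The depths used for different
  windows along one path are kept distinct by a greedy choice. This takes \<open>k / m\<close> colors; the root
  gets a color of its own, which reveals the depth of every vertex, and a number of further colors
  independent of \<open>k\<close> separates vertices of the same depth that differ only near their ends.\<close>

section \<open>Locating colorings of graphs\<close>

lemma (in wf_digraph) gdist_le_length:
  assumes "awalk u p v"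
  shows "gdist G u v \<le> ereal (real (length p))"
  unfolding gdist_eq_INF_length using assms by (intro INF_lower) simp

text \<open>Telescoping: each arc lowers \<open>f\<close> by at most 1, so a walk lowers it by at
  most its length. With \<open>f\<close> the depth, or the depth cut off at a subtree, this bounds
  tree distances from below.\<close>

lemma (in wf_digraph) potential_diff_le_gdist:
  fixes f :: "'a \<Rightarrow> int"
  assumes "\<And>x y. x \<rightarrow>\<^bsub>G\<^esub> y \<Longrightarrow> f x - f y \<le> 1"
  shows "ereal (real_of_int (f u - f v)) \<le> gdist G u v"
proof -
  have "f u - f v \<le> int (length p)" if "awalk u p v" for p
    using that
  proof (induction p arbitrary: u)
    case Nil
    then show ?case by (simp add: awalk_Nil_iff)
  next
    case (Cons e p)
    then have "e \<in> arcs G" "u = tail G e" "awalk (head G e) p v"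
      by (auto simp: awalk_Cons_iff)
    then show ?case
      using Cons.IH assms[OF in_arcs_imp_in_arcs_ends] by (fastforce simp: arc_to_ends_def)
  qed
  then show ?thesis
    unfolding gdist_eq_INF_length by (intro INF_greatest) force
qed

lemma (in wf_digraph) one_le_gdist:
  assumes "u \<noteq> v"
  shows "1 \<le> gdist G u v"
proof -
  have "1 \<le> length p" if "awalk u p v" for p
    using that assms by (cases p) (auto simp: awalk_Nil_iff)
  then show ?thesis
    unfolding gdist_eq_INF_length by (intro INF_greatest) force
qed

lemma (in wf_digraph) gdist_le_one:
  assumes "u \<rightarrow>\<^bsub>G\<^esub> v"
  shows "gdist G u v \<le> 1"
proof -
  obtain e where "awalk u [e] v"
    using assms by (auto simp: arcs_ends_def arc_to_ends_def intro: arc_implies_awalk)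
  from gdist_le_length[OF this] show ?thesis
    by (simp add: one_ereal_def)
qed

lemma (in wf_digraph) two_le_gdist:
  assumes "u \<noteq> v" "\<not> u \<rightarrow>\<^bsub>G\<^esub> v"
  shows "2 \<le> gdist G u v"
proof -
  have "2 \<le> length p" if "awalk u p v" for p
  proof (rule ccontr)
    assume "\<not> 2 \<le> length p"
    then consider "p = []" | e where "p = [e]"
      by (cases p rule: list.exhaust; cases "tl p") auto
    then show False
    proof cases
      case 1
      with that assms show False by (simp add: awalk_Nil_iff)
    next
      case 2
      with that have "e \<in> arcs G" "u = tail G e" "v = head G e"
        by (auto simp: awalk_Cons_iff awalk_Nil_iff)
      with assms in_arcs_imp_in_arcs_ends[of e] show False
        by (simp add: arc_to_ends_def)
    qed
  qed
  then show ?thesis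
    unfolding gdist_eq_INF_length by (intro INF_greatest) force
qed

text \<open>Colors may have any type here: \<open>g\<close> renames those in use. Counting only
  these keeps every class nonempty.\<close>

lemma (in digraph) locating_chromatic_number_le:
  assumes proper: "\<And>u v. u \<rightarrow>\<^bsub>G\<^esub> v \<Longrightarrow> col u \<noteq> col v"
    and sep: "\<And>u v. u \<in> verts G \<Longrightarrow> v \<in> verts G \<Longrightarrow>
      (\<And>w. w \<in> verts G \<Longrightarrow> set_gdist G u {y \<in> verts G. col y = col w}
        = set_gdist G v {y \<in> verts G. col y = col w}) \<Longrightarrow> u = v"
  shows "locating_chromatic_number G \<le> card (col ` verts G)"
proof -
  let ?k = "card (col ` verts G)"
  obtain g where g: "bij_betw g (col ` verts G) {1..?k}"
    using finite_same_card_bij[of "col ` verts G" "{1..?k}"] by auto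
  have g_eq: "g (col u) = g (col v) \<longleftrightarrow> col u = col v" if "u \<in> verts G" "v \<in> verts G" for u v
    using bij_betw_imp_inj_on[OF g] that by (auto simp: inj_on_def)
  have g_in: "g (col w) \<in> {1..?k}" if "w \<in> verts G" for w
    using g that by (auto simp: bij_betw_def)
  let ?c = "\<lambda>v. g (col v)"
  have cls: "color_class G ?c (?c w) = {y \<in> verts G. col y = col w}" if "w \<in> verts G" for w
    using g_eq that by (auto simp: color_class_def)
  have "k_coloring G ?k ?c"
    unfolding k_coloring_def
  proof (intro conjI allI impI)
    show "?c ` verts G \<subseteq> {1..?k}"
      using g_in by blast
    fix u v assume "u \<rightarrow>\<^bsub>G\<^esub> v"
    then show "?c u \<noteq> ?c v"
      using g_eq[OF adj_in_verts] proper by blast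
  qed
  moreover have "color_class G ?c i \<noteq> {}" if "i \<in> {1..?k}" for i
  proof -
    have "i \<in> g ` col ` verts G"
      unfolding bij_betw_imp_surj_on[OF g] by (rule that)
    then show ?thesis
      by (auto simp: color_class_def)
  qed
  moreover have "inj_on (color_code G ?k ?c) (verts G)"
  proof (rule inj_onI)
    fix u v assume uv: "u \<in> verts G" "v \<in> verts G" "color_code G ?k ?c u = color_code G ?k ?c v"
    show "u = v"
    proof (rule sep[OF uv(1,2)])
      fix w assume w: "w \<in> verts G"
      have "set_gdist G u (color_class G ?c (?c w)) = set_gdist G v (color_class G ?c (?c w))"
        using uv(3) g_in[OF w] unfolding color_code_def map_eq_conv set_upt by auto
      then show "set_gdist G u {y \<in> verts G. col y = col w}
        = set_gdist G v {y \<in> verts G. col y = col w}"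
        by (simp add: cls[OF w])
    qed
  qed
  ultimately have "locating_coloring G ?k ?c"
    unfolding locating_coloring_def by blast
  then show ?thesis
    unfolding locating_chromatic_number_def by (intro Least_le) blast
qed

section \<open>Distances in the trees\<close>

definition words :: "nat \<Rightarrow> nat \<Rightarrow> nat list set" where
  "words n k = {x. set x \<subseteq> {..<n} \<and> length x \<le> k}"

lemma pverts_T: "pverts (T n k) = words n k"
proof (induction k)
  case 0
  then show ?case by (auto simp: words_def)
next
  case (Suc k)
  have "x \<in> insert [] (\<Union>i<n. Cons i ` words n k) \<longleftrightarrow> x \<in> words n (Suc k)" for x
    by (cases x) (auto simp: words_def)
  with Suc show ?case
    by (auto simp: T_Suc join_copies_def simp del: T.simps(2,3))
qed

lemma parcs_T:
  "(x, y) \<in> parcs (T n k) \<longleftrightarrow>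
    (\<exists>a. y = x @ [a] \<and> y \<in> words n k \<or> x = y @ [a] \<and> x \<in> words n k)"
proof (induction k arbitrary: x y)
  case 0
  then show ?case by (auto simp: words_def)
next
  case (Suc k)
  have "(x, y) \<in> parcs (T n (Suc k)) \<longleftrightarrow>
      (\<exists>i<n. \<exists>u v. x = i # u \<and> y = i # v \<and> (u, v) \<in> parcs (T n k)) \<or>
      (\<exists>i<n. x = [] \<and> y = [i] \<or> x = [i] \<and> y = [])"
    by (auto simp: T_Suc join_copies_def simp del: T.simps(2,3))
  also have "\<dots> \<longleftrightarrow> (\<exists>a. y = x @ [a] \<and> y \<in> words n (Suc k) \<or> x = y @ [a] \<and> x \<in> words n (Suc k))"
    unfolding Suc.IH by (cases x; cases y) (auto simp: words_def)
  finally show ?case .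
qed

lemma digraph_T: "digraph (with_proj (T n k))"
proof -
  interpret G: pair_graph "T n k" by (rule pair_graph_T)
  show ?thesis by unfold_locales
qed

lemma wf_digraph_T: "wf_digraph (with_proj (T n k))"
  using digraph_T by (rule digraph.axioms(1)[THEN fin_digraph.axioms(1)])

lemma gdist_T_append_le:
  assumes "x @ w \<in> words n k"
  shows "gdist (with_proj (T n k)) (x @ w) x \<le> length w"
proof -
  interpret wf_digraph "with_proj (T n k)" by (rule wf_digraph_T)
  have "\<exists>p. awalk (x @ w) p x \<and> length p = length w"
    using assms
  proof (induction w rule: rev_induct)
    case Nil
    then show ?case
      by (intro exI[of _ "[]"]) (simp add: awalk_Nil_iff pverts_T)
  next
    case (snoc a w)
    then obtain p where p: "awalk (x @ w) p x" "length p = length w"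
      by (auto simp: words_def)
    have "(x @ w @ [a], x @ w) \<in> parcs (T n k)"
      using snoc.prems by (auto simp: parcs_T)
    with p show ?case
      by (intro exI[of _ "(x @ w @ [a], x @ w) # p"]) (auto simp: awalk_Cons_iff)
  qed
  then show ?thesis
    using gdist_le_length by metis
qed

lemma length_diff_le_gdist_T:
  "ereal (real (length u) - real (length v)) \<le> gdist (with_proj (T n k)) u v"
proof -
  interpret wf_digraph "with_proj (T n k)" by (rule wf_digraph_T)
  have "ereal (real_of_int (int (length u) - int (length v))) \<le> gdist (with_proj (T n k)) u v"
    by (rule potential_diff_le_gdist) (auto simp: parcs_T)
  then show ?thesis by simp
qed

text \<open>Here \<open>y\<close> lies outside the subtree of the ancestor of \<open>u\<close> at
  depth \<open>p\<close>, so a walk must climb to that ancestor and take one more step to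
  leave.\<close>

lemma gdist_T_outside_ge:
  assumes "p \<le> length u" "take p u \<noteq> take p y"
  shows "ereal (real (length u) - real p + 1) \<le> gdist (with_proj (T n k)) u y"
proof -
  interpret wf_digraph "with_proj (T n k)" by (rule wf_digraph_T)
  \<comment> \<open>Height above the parent of the subtree root, and 0 outside; the only arc
    crossing the border joins heights 1 and 0.\<close>
  define f where "f x = (if take p u = take p x then int (length x) - int p + 1 else 0)" for x
  have len: "p \<le> length x" if "take p u = take p x" for x
    using assms(1) arg_cong[OF that, of length] by simp
  have snoc: "\<bar>f (x @ [a]) - f x\<bar> \<le> 1" for x a
  proof (cases "p \<le> length x")
    case True
    then show ?thesis by (auto simp: f_def)
  next
    case False
    then have "take p u \<noteq> take p x"
      using len by blast
    moreover have "length x + 1 = p" if "take p u = take p (x @ [a])"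
      using False len[OF that] by simp
    ultimately show ?thesis by (auto simp: f_def)
  qed
  have "ereal (real_of_int (f u - f y)) \<le> gdist (with_proj (T n k)) u y"
  proof (rule potential_diff_le_gdist)
    fix x z assume "x \<rightarrow>\<^bsub>with_proj (T n k)\<^esub> z"
    then obtain a where "z = x @ [a] \<or> x = z @ [a]"
      by (auto simp: parcs_T)
    then show "f x - f z \<le> 1"
      using snoc[of x a] snoc[of z a] by auto
  qed
  moreover have "f u - f y = int (length u) - int p + 1"
    using assms by (simp add: f_def)
  ultimately show ?thesis by simp
qed

section \<open>Encoding windows by depths\<close>

locale window_depths =
  fixes n M :: nat
  assumes n_pos: "n \<ge> 1" and M_ge_2: "M \<ge> 2"
begin

definition N :: nat where
  "N = n ^ (2 * M)"

definition letters :: "nat list set" where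
  "letters = {w. set w \<subseteq> {..<n} \<and> length w = 2 * M}"

definition window :: "nat \<Rightarrow> nat list \<Rightarrow> nat list" where
  "window i x = take (2 * M) (drop (i * (2 * M)) x)"

text \<open>In halved units, the start is the depth at which window \<open>i\<close> ends. Of the
  \<open>2 * N\<close> values up to \<open>N\<close> may be taken, which leaves one for each of the
  \<open>N\<close> words in \<open>letters\<close>.\<close>

definition span :: "nat \<Rightarrow> nat set" where
  "span i = {(i + 1) * M..<(i + 1) * M + 2 * N}"

text \<open>\<open>U\<close> holds the values of earlier windows. The choice depends on
  \<open>U\<close> and \<open>i\<close> alone, so vertices agreeing before window \<open>i\<close>
  use the same injection.\<close>

definition encoding :: "nat set \<Rightarrow> nat \<Rightarrow> nat list \<Rightarrow> nat" where
  "encoding U i = (SOME g. inj_on g letters \<and> g ` letters \<subseteq> span i - U)"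

text \<open>Half of the depth encoding the \<open>i\<close>-th window: only even depths are used, such that the
  children of a vertex at an encoding depth are free for other purposes.\<close>
function half_depth :: "nat \<Rightarrow> nat list \<Rightarrow> nat" where
  "half_depth i x = encoding ((\<lambda>j. half_depth j x) ` {..<i}) i (window i x)"
  by auto
termination by (relation "measure fst") auto

declare half_depth.simps [simp del]

lemma card_letters: "card letters = N" and finite_letters: "finite letters"
  by (simp_all add: letters_def N_def card_lists_length_eq finite_lists_length_eq)

lemma window_in_letters:
  assumes "set x \<subseteq> {..<n}" "(i + 1) * (2 * M) \<le> length x"
  shows "window i x \<in> letters"
  using assms by (auto simp: window_def letters_def dest!: in_set_takeD in_set_dropD)

lemma encoding:
  assumes "card (U \<inter> span i) \<le> N"
  shows "inj_on (encoding U i) letters" "encoding U i ` letters \<subseteq> span i - U"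
proof -
  have "card (span i - U) = card (span i) - card (U \<inter> span i)"
    by (simp add: card_Diff_subset_Int Int_commute span_def)
  then have "card letters \<le> card (span i - U)"
    using assms by (simp add: card_letters span_def)
  then have "\<exists>g. inj_on g letters \<and> g ` letters \<subseteq> span i - U"
    using card_le_inj[OF finite_letters, of "span i - U"] by (auto simp: span_def)
  from someI_ex[OF this]
  show "inj_on (encoding U i) letters" "encoding U i ` letters \<subseteq> span i - U"
    by (auto simp: encoding_def)
qed

text \<open>Two spans intersect only if their indices differ by less than \<open>N\<close>.\<close>
lemma card_used_le:
  assumes "\<And>j. j < i \<Longrightarrow> f j \<in> span j"
  shows "card (f ` {..<i} \<inter> span i) \<le> N"
proof -
  have "f ` {..<i} \<inter> span i \<subseteq> f ` {i - N..<i}"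
  proof clarify
    fix j assume j: "j < i" "f j \<in> span i"
    have "i - N \<le> j"
    proof (rule ccontr)
      assume "\<not> i - N \<le> j"
      then have "(j + 1 + N) * M \<le> (i + 1) * M"
        by (intro mult_right_mono) auto
      also have "\<dots> < (j + 1) * M + 2 * N"
        using j assms[of j] by (simp add: span_def)
      \<comment> \<open>Advancing by \<open>N\<close> windows shifts the start of a span by
        \<open>N * M\<close>, at least its length \<open>2 * N\<close>.\<close>
      also have "\<dots> \<le> (j + 1 + N) * M"
        using M_ge_2 by (simp add: algebra_simps)
      finally show False by simp
    qed
    with j show "f j \<in> f ` {i - N..<i}" by auto
  qed
  then have "card (f ` {..<i} \<inter> span i) \<le> card (f ` {i - N..<i})"
    by (intro card_mono) auto
  also have "\<dots> \<le> N"
    using card_image_le[of "{i - N..<i}" f] by simp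
  finally show ?thesis .
qed

text \<open>Strong induction: the count in \<open>card_used_le\<close> presupposes that all earlier
  values lie in their spans.\<close>

lemma half_depth_in_span:
  assumes "set x \<subseteq> {..<n}" "(i + 1) * (2 * M) \<le> length x"
  shows "half_depth i x \<in> span i"
  using assms(2)
proof (induction i rule: less_induct)
  case (less i)
  have "half_depth j x \<in> span j" if "j < i" for j
  proof (rule less.IH[OF that])
    have "(j + 1) * (2 * M) \<le> (i + 1) * (2 * M)"
      using that by (intro mult_right_mono) auto
    with less.prems show "(j + 1) * (2 * M) \<le> length x" by linarith
  qed
  from encoding(2)[OF card_used_le[of i "\<lambda>j. half_depth j x", OF this]]
  show ?case
    using window_in_letters[OF assms(1) less.prems] by (subst half_depth.simps) auto
qed

lemma card_used_half_depth_le: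
  assumes "set x \<subseteq> {..<n}" "(i + 1) * (2 * M) \<le> length x"
  shows "card ((\<lambda>j. half_depth j x) ` {..<i} \<inter> span i) \<le> N"
proof (rule card_used_le)
  fix j assume "j < i"
  then have "(j + 1) * (2 * M) \<le> (i + 1) * (2 * M)"
    by (intro mult_right_mono) auto
  with assms show "half_depth j x \<in> span j"
    by (intro half_depth_in_span) linarith+
qed

lemma half_depth_neq:
  assumes "set x \<subseteq> {..<n}" "(i + 1) * (2 * M) \<le> length x" "j < i"
  shows "half_depth j x \<noteq> half_depth i x"
  using encoding(2)[OF card_used_half_depth_le[OF assms(1,2)]]
    window_in_letters[OF assms(1,2)] assms(3)
  by (subst (2) half_depth.simps) auto

lemma window_cong:
  assumes "take ((i + 1) * (2 * M)) x = take ((i + 1) * (2 * M)) y"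
  shows "window i x = window i y"
proof -
  have "window i z = drop (i * (2 * M)) (take ((i + 1) * (2 * M)) z)" for z
    by (simp add: window_def drop_take)
  then show ?thesis
    using assms by simp
qed

lemma take_mono_eq:
  assumes "take q x = take q y" "p \<le> q"
  shows "take p x = take p y"
  using arg_cong[OF assms(1), of "take p"] assms(2) by (simp add: min_absorb1)

text \<open>The recursion reads only window \<open>i\<close> and earlier values, so the value is
  constant on each subtree rooted where window \<open>i\<close> ends.\<close>

lemma half_depth_cong:
  assumes "take ((i + 1) * (2 * M)) x = take ((i + 1) * (2 * M)) y"
  shows "half_depth i x = half_depth i y"
  using assms
proof (induction i rule: less_induct)
  case (less i)
  have "half_depth j x = half_depth j y" if "j < i" for j
  proof (rule less.IH[OF that take_mono_eq[OF less.prems]])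
    show "(j + 1) * (2 * M) \<le> (i + 1) * (2 * M)"
      using that by (intro mult_right_mono) auto
  qed
  then have "(\<lambda>j. half_depth j x) ` {..<i} = (\<lambda>j. half_depth j y) ` {..<i}"
    by (intro image_cong) auto
  then show ?case
    using window_cong[OF less.prems] by (simp add: half_depth.simps[of i])
qed

text \<open>The common prefix forces equal earlier values, hence the same avoided set and the same
  injection for both vertices.\<close>

lemma half_depth_neq_of_window_neq:
  assumes "set x \<subseteq> {..<n}" "set y \<subseteq> {..<n}"
    and "(i + 1) * (2 * M) \<le> length x" "(i + 1) * (2 * M) \<le> length y"
    and eq: "take (i * (2 * M)) x = take (i * (2 * M)) y" and neq: "window i x \<noteq> window i y"
  shows "half_depth i x \<noteq> half_depth i y"
proof -
  have "half_depth j x = half_depth j y" if "j < i" for j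
  proof (rule half_depth_cong[OF take_mono_eq[OF eq]])
    show "(j + 1) * (2 * M) \<le> i * (2 * M)"
      using that by (intro mult_right_mono) auto
  qed
  then have *: "(\<lambda>j. half_depth j x) ` {..<i} = (\<lambda>j. half_depth j y) ` {..<i}"
    by (intro image_cong) auto
  show ?thesis
    using inj_onD[OF encoding(1)[OF card_used_half_depth_le[OF assms(1,3)]],
        of "window i x" "window i y"]
      window_in_letters[OF assms(1,3)] window_in_letters[OF assms(2,4)] neq *
    by (auto simp: half_depth.simps[of i])
qed

end

section \<open>The coloring\<close>

datatype color = Root | Window nat | Filler nat "nat list"

locale tree_coloring = window_depths +
  fixes k :: nat
begin

text \<open>Stopping short of \<open>k\<close> keeps all encoding depths below \<open>k\<close>, so every vertex at such a depth
  has children.\<close>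
definition r :: nat where
  "r = (k - 4 * N) div (2 * M)"

text \<open>The length of a window plus the doubled length of a span: vertices of equal depth that
  no window separates first differ within this range of their ends. The extra 1 leaves room for the
  letter of a child.\<close>

definition Q :: nat where
  "Q = 2 * M + 4 * N + 1"

definition owns :: "nat \<Rightarrow> nat list \<Rightarrow> bool" where
  "owns i x \<longleftrightarrow> i < r \<and> (i + 1) * (2 * M) \<le> length x \<and> 2 * half_depth i x = length x"

text \<open>Residues modulo 3, not 2, let a filler color tell the children of a vertex from its
  parent as well as from itself. Reversal makes \<open>take\<close> keep the last letters.\<close>

definition col :: "nat list \<Rightarrow> color" where
  "col x = (if x = [] then Root
    else if \<exists>i. owns i x then Window (SOME i. owns i x)
    else Filler (length x mod 3) (take Q (rev x)))"

abbreviation G where "G \<equiv> with_proj (T n k)"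

section \<open>Properness of the coloring\<close>

lemma owns_unique:
  assumes "set x \<subseteq> {..<n}" "owns i x" "owns j x"
  shows "i = j"
  using half_depth_neq[OF assms(1), of i j] half_depth_neq[OF assms(1), of j i] assms(2,3)
  by (cases i j rule: linorder_cases) (auto simp: owns_def)

lemma not_owns_Nil: "\<not> owns i []"
  using M_ge_2 by (simp add: owns_def)

lemma col_eq_Root_iff: "col x = Root \<longleftrightarrow> x = []"
  by (simp add: col_def)

lemma col_eq_Window_iff:
  assumes "set x \<subseteq> {..<n}"
  shows "col x = Window i \<longleftrightarrow> owns i x"
proof -
  have "(SOME i. owns i x) = i" if "owns i x"
    using someI[of "\<lambda>i. owns i x", OF that] owns_unique[OF assms _ that] by blast
  then show ?thesis
    using not_owns_Nil by (auto simp: col_def intro: someI)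
qed

lemma col_eq_Filler_iff:
  "col x = Filler a w \<longleftrightarrow>
    x \<noteq> [] \<and> (\<nexists>i. owns i x) \<and> a = length x mod 3 \<and> w = take Q (rev x)"
  by (auto simp: col_def)

lemma depth_bound:
  assumes "i < r"
  shows "(i + 1) * (2 * M) + 4 * N \<le> k"
proof -
  have "(i + 1) * (2 * M) \<le> r * (2 * M)"
    using assms by (intro mult_right_mono) auto
  also have "\<dots> \<le> k - 4 * N"
    by (simp add: r_def)
  finally have "(i + 1) * (2 * M) \<le> k - 4 * N" .
  moreover have "(i + 1) * (2 * M) > 0"
    using M_ge_2 by simp
  ultimately show ?thesis by linarith
qed

lemma half_depth_bounds:
  assumes "set x \<subseteq> {..<n}" "(i + 1) * (2 * M) \<le> length x"
  shows "(i + 1) * (2 * M) \<le> 2 * half_depth i x" "2 * half_depth i x < (i + 1) * (2 * M) + 4 * N"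
  using half_depth_in_span[OF assms] by (auto simp: span_def)

text \<open>Evenness keeps a vertex and its child from both owning a window; the depth bound ensures
  that an owning vertex has a child.\<close>

lemma owns_even_less:
  assumes "set x \<subseteq> {..<n}" "owns i x"
  shows "even (length x)" "length x < k"
proof -
  have *: "i < r" "(i + 1) * (2 * M) \<le> length x" "2 * half_depth i x = length x"
    using assms(2) by (simp_all add: owns_def)
  show "length x < k"
    using depth_bound[OF *(1)] half_depth_bounds[OF assms(1) *(2)] *(3) by linarith
  show "even (length x)"
    using *(3) by presburger
qed

lemma col_snoc_neq:
  assumes "set (x @ [a]) \<subseteq> {..<n}"
  shows "col (x @ [a]) \<noteq> col x"
proof (cases "col x")
  case Root
  then show ?thesis
    using col_eq_Root_iff by (metis snoc_eq_iff_butlast)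
next
  case (Window i)
  then have "even (length x)"
    using owns_even_less(1)[of x i] col_eq_Window_iff[of x i] assms by auto
  then have "\<not> owns i (x @ [a])"
    using owns_even_less(1)[OF assms, of i] by auto
  then show ?thesis
    using col_eq_Window_iff[OF assms, of i] Window by simp
next
  case (Filler b w)
  then have "b = length x mod 3"
    by (simp add: col_eq_Filler_iff)
  then have "b \<noteq> length (x @ [a]) mod 3"
    by (simp add: mod_Suc)
  then show ?thesis
    using Filler col_eq_Filler_iff by metis
qed

section \<open>Distances to the color classes\<close>

lemma set_gdist_Root:
  assumes "u \<in> words n k"
  shows "set_gdist G u {y \<in> words n k. col y = col []} = length u"
proof -
  have "{y \<in> words n k. col y = col []} = {[]}"
    by (auto simp: col_def words_def)
  then have "set_gdist G u {y \<in> words n k. col y = col []} = gdist G u []"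
    by (simp add: set_gdist_def)
  also have "\<dots> = length u"
    using gdist_T_append_le[of "[]" u n k] length_diff_le_gdist_T[of u "[]" n k] assms
    by (intro antisym) auto
  finally show ?thesis .
qed

text \<open>The nearest vertex of color \<open>Window i\<close> is the ancestor of \<open>u\<close>
  at the encoding depth: below the end of window \<open>i\<close> all vertices of this color share
  that depth, and those elsewhere are farther away.\<close>

lemma set_gdist_Window:
  assumes u: "u \<in> words n k" and i: "i < r" "(i + 1) * (2 * M) + 4 * N \<le> length u"
  shows "set_gdist G u {y \<in> words n k. col y = Window i} = real (length u) - real (2 * half_depth i u)"
    and "\<exists>y \<in> words n k. col y = Window i"
proof -
  let ?p = "(i + 1) * (2 * M)" and ?l = "2 * half_depth i u"
  have su: "set u \<subseteq> {..<n}" and pu: "?p \<le> length u"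
    using u i by (auto simp: words_def)
  note b = half_depth_bounds[OF su pu]
  let ?y = "take ?l u"
  have ly: "length ?y = ?l"
    using b i by simp
  have "half_depth i ?y = half_depth i u"
    using b by (intro half_depth_cong) (simp add: min_absorb1)
  then have "owns i ?y"
    using b i unfolding owns_def ly by simp
  moreover have y: "?y \<in> words n k"
    using u by (auto simp: words_def dest: in_set_takeD)
  ultimately have cy: "col ?y = Window i"
    using col_eq_Window_iff[of ?y i] by (simp add: words_def)
  with y show "\<exists>y \<in> words n k. col y = Window i"
    by blast
  show "set_gdist G u {y \<in> words n k. col y = Window i} = real (length u) - real ?l"
    unfolding set_gdist_def
  proof (rule antisym)
    have "gdist G u ?y \<le> length (drop ?l u)"
      using gdist_T_append_le[of ?y "drop ?l u" n k] u by (simp only: append_take_drop_id)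
    also have "\<dots> = ereal (real (length u) - real ?l)"
      using b i by (simp add: of_nat_diff)
    finally show "(INF y\<in>{y \<in> words n k. col y = Window i}. gdist G u y)
        \<le> ereal (real (length u) - real ?l)"
      using y cy by (intro INF_lower2[of ?y]) auto
    show "ereal (real (length u) - real ?l)
        \<le> (INF y\<in>{y \<in> words n k. col y = Window i}. gdist G u y)"
    proof (rule INF_greatest)
      fix y assume "y \<in> {y \<in> words n k. col y = Window i}"
      then have o: "owns i y"
        using col_eq_Window_iff[of y i] by (auto simp: words_def)
      show "ereal (real (length u) - real ?l) \<le> gdist G u y"
      proof (cases "take ?p u = take ?p y")
        case True
        then have "half_depth i u = half_depth i y"
          by (rule half_depth_cong)
        then have "length y = ?l"
          using o by (simp add: owns_def)
        then show ?thesis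
          using length_diff_le_gdist_T[of u y n k] by simp
      next
        case False
        \<comment> \<open>Leaving the subtree is no shortcut, as the encoding depth
          \<open>?l\<close> is at least \<open>?p\<close>, where window \<open>i\<close>
          ends.\<close>
        have "ereal (real (length u) - real ?l) \<le> ereal (real (length u) - real ?p + 1)"
          using of_nat_mono[OF b(1), where 'a = real] by simp
        also have "\<dots> \<le> gdist G u y"
          by (rule gdist_T_outside_ge[OF pu False])
        finally show ?thesis .
      qed
    qed
  qed
qed

text \<open>A non-leaf vertex at an encoding depth is told apart by the filler color of its children.\<close>
lemma set_gdist_Filler_neq:
  assumes u: "u \<in> words n k" and v: "v \<in> words n k" and l: "length u = length v"
    and neq: "take (Q - 1) (rev u) \<noteq> take (Q - 1) (rev v)"
  shows "\<exists>w\<in>words n k.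
    set_gdist G u {y \<in> words n k. col y = col w} \<noteq> set_gdist G v {y \<in> words n k. col y = col w}"
proof -
  interpret wf_digraph G by (rule wf_digraph_T)
  have u0: "u \<noteq> []"
    using neq l by auto
  have take_Q: "take Q (a # z) = a # take (Q - 1) z" for a and z :: "nat list"
    by (simp add: Q_def)
  have neq': "take Q (rev u) \<noteq> take Q (rev v)"
    using neq take_mono_eq[of Q "rev u" "rev v" "Q - 1"] by auto
  show ?thesis
  proof (cases "\<exists>i. owns i u")
    \<comment> \<open>The filler color of \<open>u\<close> itself has distance 0 from
      \<open>u\<close> but not from \<open>v\<close>, whose last letters differ.\<close>
    case False
    then have cu: "col u = Filler (length u mod 3) (take Q (rev u))"
      using u0 by (simp add: col_eq_Filler_iff)
    have near: "set_gdist G u {y \<in> words n k. col y = col u} \<le> 0"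
      unfolding set_gdist_def using gdist_T_append_le[of u "[]" n k] u
      by (intro INF_lower2[of u]) (auto simp: zero_ereal_def)
    have far: "1 \<le> set_gdist G v {y \<in> words n k. col y = col u}"
      unfolding set_gdist_def
    proof (rule INF_greatest)
      fix y assume "y \<in> {y \<in> words n k. col y = col u}"
      then have "y \<noteq> v"
        using cu neq' by (auto simp: col_eq_Filler_iff)
      then show "1 \<le> gdist G v y"
        by (intro one_le_gdist) simp
    qed
    have "(0 :: ereal) < 1"
      by simp
    show ?thesis
      using le_less_trans[OF near less_le_trans[OF \<open>0 < 1\<close> far]]
      by (intro bexI[OF _ u]) simp
  next
    case True
    \<comment> \<open>A child of \<open>u\<close> has odd depth and is therefore a filler
      vertex.\<close>
    let ?x = "u @ [0]"
    have "even (length u)" "length u < k"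
      using True owns_even_less[of u] u by (auto simp: words_def)
    then have x: "?x \<in> words n k"
      using u n_pos by (auto simp: words_def)
    then have "\<nexists>i. owns i ?x"
      using owns_even_less(1)[of ?x] \<open>even (length u)\<close> by (auto simp: words_def)
    then have cx: "col ?x = Filler (Suc (length u) mod 3) (0 # take (Q - 1) (rev u))"
      by (subst col_eq_Filler_iff) (simp add: take_Q)
    have near: "set_gdist G u {y \<in> words n k. col y = col ?x} \<le> 1"
      unfolding set_gdist_def using x gdist_le_one[of u ?x]
      by (intro INF_lower2[of ?x]) (auto simp: parcs_T)
    \<comment> \<open>In this class, residues modulo 3 rule out \<open>v\<close> and its parent; the
      letters of \<open>u\<close> stored in the color rule out the children of
      \<open>v\<close>.\<close>
    have far: "2 \<le> set_gdist G v {y \<in> words n k. col y = col ?x}"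
      unfolding set_gdist_def
    proof (rule INF_greatest)
      fix y assume "y \<in> {y \<in> words n k. col y = col ?x}"
      then have y: "length y mod 3 = Suc (length v) mod 3"
          "take Q (rev y) = 0 # take (Q - 1) (rev u)"
        using cx l by (auto simp: col_eq_Filler_iff)
      have "v \<noteq> y"
        using y(1) by (auto simp: mod_Suc split: if_splits)
      moreover have "\<not> v \<rightarrow>\<^bsub>G\<^esub> y"
      proof
        assume "v \<rightarrow>\<^bsub>G\<^esub> y"
        then obtain a where "y = v @ [a] \<or> v = y @ [a]"
          by (auto simp: parcs_T)
        then show False
        proof
          assume "y = v @ [a]"
          then have "take Q (rev y) = a # take (Q - 1) (rev v)"
            by (simp only: rev.simps rev_append append.simps take_Q)
          with y(2) neq show False
            by simp
        next
          assume "v = y @ [a]"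
          then have "length v = Suc (length y)"
            by simp
          with y(1) show False
            by presburger
        qed
      qed
      ultimately show "2 \<le> gdist G v y"
        by (rule two_le_gdist)
    qed
    have "(1 :: ereal) < 2"
      by simp
    show ?thesis
      using le_less_trans[OF near less_le_trans[OF \<open>1 < 2\<close> far]]
      by (intro bexI[OF _ x]) simp
  qed
qed

text \<open>The root color shows that the depths agree. Either the window of the first difference is
  encoded above both vertices, and the distances to its color differ, or the difference is near the
  ends and a filler color shows it.\<close>

lemma col_inj:
  assumes u: "u \<in> words n k" and v: "v \<in> words n k"
    and same: "\<And>w. w \<in> words n k \<Longrightarrow>
      set_gdist G u {y \<in> words n k. col y = col w} = set_gdist G v {y \<in> words n k. col y = col w}"
  shows "u = v"
proof (rule ccontr)
  assume "u \<noteq> v"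
  have l: "length u = length v"
    using same[of "[]"] set_gdist_Root[OF u] set_gdist_Root[OF v] by (simp add: words_def)
  have su: "set u \<subseteq> {..<n}" and sv: "set v \<subseteq> {..<n}"
    using u v by (auto simp: words_def)
  obtain pre x xs y ys where d: "x \<noteq> y" "u = pre @ [x] @ xs" "v = pre @ [y] @ ys"
    using same_length_different[OF \<open>u \<noteq> v\<close> l] by blast
  have lys: "length ys = length xs"
    using d l by simp
  \<comment> \<open>The window containing the first differing letter.\<close>
  let ?i = "length pre div (2 * M)"
  have i1: "?i * (2 * M) \<le> length pre" and i2: "length pre < (?i + 1) * (2 * M)"
    using M_ge_2 dividend_less_div_times[of "2 * M" "length pre"] div_times_less_eq_dividend
    by (simp_all add: add.commute)
  show False
  proof (cases "?i < r \<and> (?i + 1) * (2 * M) + 4 * N \<le> length u")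
    case True
    then have i: "?i < r" "(?i + 1) * (2 * M) + 4 * N \<le> length u"
      "(?i + 1) * (2 * M) + 4 * N \<le> length v"
      using l by auto
    have pu: "(?i + 1) * (2 * M) \<le> length u" and pv: "(?i + 1) * (2 * M) \<le> length v"
      using i by linarith+
    have j: "length pre - ?i * (2 * M) < 2 * M"
      using i1 i2 by (simp add: algebra_simps)
    have nth: "window ?i z ! (length pre - ?i * (2 * M)) = z ! length pre"
      if "(?i + 1) * (2 * M) \<le> length z" for z
    proof -
      have "?i * (2 * M) \<le> length z"
        using that by simp
      then show ?thesis
        unfolding window_def using j i1 by (subst nth_take) (simp_all del: div_times_less_eq_dividend)
    qed
    have "u ! length pre \<noteq> v ! length pre"
      using d by simp
    then have "window ?i u \<noteq> window ?i v"
      using nth[OF pu] nth[OF pv] by metis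
    moreover have "take (?i * (2 * M)) u = take (?i * (2 * M)) v"
      using d i1 by simp
    ultimately have "half_depth ?i u \<noteq> half_depth ?i v"
      using half_depth_neq_of_window_neq[OF su sv pu pv] by blast
    moreover obtain w where w: "w \<in> words n k" "col w = Window ?i"
      using set_gdist_Window(2)[OF u i(1,2)] by blast
    ultimately show False
      using same[OF w(1)] set_gdist_Window(1)[OF u i(1,2)] set_gdist_Window(1)[OF v i(1,3)] l
      unfolding w(2) by simp
  next
    case False
    have "length u < length pre + Q"
    proof (cases "?i < r")
      case True
      with False have "length u < (?i + 1) * (2 * M) + 4 * N"
        by simp
      also have "\<dots> \<le> length pre + Q"
        using i1 by (simp add: Q_def algebra_simps)
      finally show ?thesis .
    next
      case False
      \<comment> \<open>Now \<open>pre\<close> reaches past all \<open>r\<close> windows, and these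
        leave less than \<open>2 * M + 4 * N\<close> of the depth \<open>k\<close>
        uncovered.\<close>
      then have "r * (2 * M) \<le> ?i * (2 * M)"
        by (intro mult_right_mono) auto
      moreover have "k - 4 * N < r * (2 * M) + 2 * M"
        unfolding r_def using M_ge_2 dividend_less_div_times[of "2 * M" "k - 4 * N"] by simp
      moreover have "length u \<le> k"
        using u by (simp add: words_def)
      ultimately show ?thesis
        using i1 unfolding Q_def by linarith
    qed
    then have lxs: "length xs < Q - 1"
      using d by simp
    have "take (Q - 1) (rev u) ! length xs = x"
      using lxs by (simp add: d(2) nth_append)
    moreover have "take (Q - 1) (rev v) ! length ys = y"
      using lxs lys by (simp add: d(3) nth_append)
    ultimately have "take (Q - 1) (rev u) \<noteq> take (Q - 1) (rev v)"
      using d(1) lys by metis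
    then show False
      using set_gdist_Filler_neq[OF u v l] same by blast
  qed
qed

section \<open>Number of colors and the limit\<close>

definition filler_count :: nat where
  "filler_count = 3 * card (words n Q)"

text \<open>Shallow vertices have suffixes shorter than \<open>Q\<close>, hence the count over
  \<open>words n Q\<close>. Of the summands only \<open>r\<close> depends on
  \<open>k\<close>.\<close>

lemma card_col_le: "card (col ` words n k) \<le> 1 + r + filler_count"
proof -
  let ?F = "(\<lambda>(a, w). Filler a w) ` ({..<3} \<times> words n Q)"
  have fin: "finite (words n Q)"
    unfolding words_def by (rule finite_lists_length_le) simp
  have "col x \<in> {Root} \<union> Window ` {..<r} \<union> ?F" if x: "x \<in> words n k" for x
  proof (cases "col x")
    case (Window i)
    with x have "owns i x"
      using col_eq_Window_iff[of x i] by (simp add: words_def)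
    with Window show ?thesis by (auto simp: owns_def)
  next
    case (Filler a w)
    then have "a = length x mod 3" "w = take Q (rev x)"
      by (simp_all add: col_eq_Filler_iff)
    then have "(a, w) \<in> {..<3} \<times> words n Q"
      using x by (auto simp: words_def dest!: in_set_takeD)
    with Filler show ?thesis by force
  qed simp
  then have "card (col ` words n k) \<le> card ({Root} \<union> Window ` {..<r} \<union> ?F)"
    using fin by (intro card_mono) auto
  also have "\<dots> \<le> card {Root} + card (Window ` {..<r}) + card ?F"
    by (meson card_Un_le order_trans add_right_mono)
  also have "\<dots> \<le> 1 + r + filler_count"
    using card_image_le[of "{..<r}" Window] card_image_le[of "{..<3} \<times> words n Q" "\<lambda>(a, w). Filler a w"]
      fin by (simp add: filler_count_def card_cartesian_product)
  finally show ?thesis .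
qed

lemma locating_chromatic_number_T_le:
  "real (locating_chromatic_number G) \<le> real k / (2 * M) + (1 + filler_count)"
proof -
  interpret digraph G by (rule digraph_T)
  have "locating_chromatic_number G \<le> card (col ` verts G)"
  proof (rule locating_chromatic_number_le)
    fix x y assume "x \<rightarrow>\<^bsub>G\<^esub> y"
    then obtain a where "y = x @ [a] \<and> y \<in> words n k \<or> x = y @ [a] \<and> x \<in> words n k"
      by (auto simp: parcs_T)
    then show "col x \<noteq> col y"
      using col_snoc_neq[of x a] col_snoc_neq[of y a] by (auto simp: words_def)
  next
    fix u v assume "u \<in> verts G" "v \<in> verts G"
      "\<And>w. w \<in> verts G \<Longrightarrow> set_gdist G u {y \<in> verts G. col y = col w}
        = set_gdist G v {y \<in> verts G. col y = col w}"
    then show "u = v"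
      by (intro col_inj) (simp_all add: pverts_T)
  qed
  also have "\<dots> \<le> 1 + r + filler_count"
    using card_col_le by (simp add: pverts_T)
  finally have "real (locating_chromatic_number G) \<le> 1 + real r + filler_count"
    by linarith
  also have "real r \<le> real (k - 4 * N) / real (2 * M)"
    unfolding r_def by (rule of_nat_div_le_of_nat)
  also have "\<dots> \<le> real k / real (2 * M)"
    by (intro divide_right_mono) auto
  finally show ?thesis by simp
qed

end

lemma (in window_depths) eventually_ratio_le:
  "\<forall>\<^sub>F k in sequentially. real (locating_chromatic_number (with_proj (T n k))) / real k \<le> 1 / M"
proof -
  define C where "C = 1 + real (tree_coloring.filler_count n M)"
  show ?thesis
    \<comment> \<open>From this threshold on \<open>C\<close> is at most \<open>k / (2 * M)\<close>,
      so the bound \<open>k / (2 * M) + C\<close> becomes \<open>k / M\<close>.\<close>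
    using eventually_ge_at_top[of "nat \<lceil>2 * M * C\<rceil> + 1"]
  proof eventually_elim
    case (elim k)
    interpret tree_coloring n M k by unfold_locales
    have k: "k > 0" "2 * M * C \<le> real k"
      using elim by linarith+
    have "C \<le> real k / (2 * M)"
      using k M_ge_2 by (simp add: field_simps)
    then have "real (locating_chromatic_number G) \<le> real k / M"
      using locating_chromatic_number_T_le unfolding C_def by (simp add: field_simps)
    then show ?case
      using k by (simp add: field_simps)
  qed
qed

theorem theorem3:
  fixes n :: nat
  assumes "n \<ge> 3"
  shows "(\<lambda>k. real (locating_chromatic_number (with_proj (T n k))) / real k) \<longlonglongrightarrow> 0"
proof (rule tendstoI)
  fix e :: real assume "e > 0"
  then obtain M0 :: nat where M0: "M0 > 0" "1 / real M0 < e"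
    by (metis nat_approx_posE of_nat_Suc zero_less_Suc)
  \<comment> \<open>Adding 2 meets the locale assumption \<open>M_ge_2\<close> and only lowers the
    bound \<open>1 / M\<close>.\<close>
  define M where "M = M0 + 2"
  interpret window_depths n M
    using assms by unfold_locales (simp_all add: M_def)
  have "1 / real M \<le> 1 / real M0"
    using M0(1) unfolding M_def by (intro divide_left_mono) auto
  with M0(2) have "1 / real M < e" by linarith
  with eventually_ratio_le show "\<forall>\<^sub>F k in sequentially.
      dist (real (locating_chromatic_number (with_proj (T n k))) / real k) 0 < e"
    by (auto elim!: eventually_mono)
qed

end
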